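(* Let $I\ne\emptyset$ be a finite or countable set and let $((X_i,\|\cdot\|_{X_i}))_{i\in I}$ be real normed spaces. For each $i\in I$ suppose that $b_i:X_i\to(-\infty,\infty]$ is strongly convex on some nonempty subset $S_i$ of $C_i:=\mathrm{dom}(b_i)$ with a strong convexity parameter $\mu_i$. Assume that $\mu:=\inf\{\mu_i:i\in I\}>0$. Define $X:=\{(x_i)_{i\in I}:x_i\in X_i\ \forall i\in I,\ \sum_{i\in I}\|x_i\|_{X_i}^2<\infty\}$ and endow $X$ with an arbitrary norm $\|\cdot\|$ for which there exists $c>0$ such that $\|(x_i)_{i\in I}\|_{\#}\ge c\|(x_i)_{i\in I}\|$ for each $(x_i)_{i\in I}\in X$, where $\|(x_i)_{i\in I}\|_{\#}:=\sqrt{\sum_{i\in I}\|x_i\|_{X_i}^2}$. Assume that $\sum_{i\in I}b_i(x_i)$ converges to a real number for each $(x_i)_{i\in I}\in C:=\bigoplus_{i\in I}\mathrm{dom}(b_i)$, and let $b:X\to(-\infty,\infty]$ be defined by $b((x_i)_{i\in I}):=\sum_{i\in I}b_i(x_i)$ if $(x_i)_{i\in I}\in C$ and $b((x_i)_{i\in I}):=\infty$ if $(x_i)_{i\in I}\notin C$. Then $b$ is strongly convex on $S:=\bigoplus_{i\in I}S_i$ with $\mu[S]:=c^2\mu$ as a strong convexity parameter.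
   Context: $\mathrm{dom}(f):=\{x:f(x)<\infty\}$. For subsets $A_i\subseteq X_i$, $\bigoplus_{i\in I}A_i:=\{(x_i)_{i\in I}\in X:x_i\in A_i\ \forall i\in I\}$. If $I$ is infinite, sums over $I$ are taken with respect to a fixed enumeration of $I$. For a convex function $f$ on a normed space with values in $(-\infty,\infty]$ and a subset $S\subseteq\mathrm{dom}(f)$ (not necessarily convex), $f$ is strongly convex on $S$ with strong convexity parameter $\mu>0$ if $f(\lambda x+(1-\lambda)y)+\tfrac12\mu\lambda(1-\lambda)\|x-y\|^2\le\lambda f(x)+(1-\lambda)f(y)$ for all $x,y\in S$ and $\lambda\in(0,1)$. Strong convexity of $b_i$ on $S_i$ presupposes that $b_i$ is convex on $X_i$. *)

theory Defs
  imports
    "HOL-Algebra.Algebraic_Closure_Type"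
    "HOL-Algebra.Module"
    "HOL-Library.Extended_Real"
    "HOL-Library.Countable_Set"
begin

subsection \<open>Real normed spaces with explicit carrier\<close>

text \<open>
  The spaces of a family may all be different, so a real vector space is a module over the field
  of real numbers, with its own carrier set and operations.
\<close>

abbreviation real_ring :: "real ring"
  where "real_ring \<equiv> ring_of_type_algebra"

definition norm_on :: "(real, 'a) module \<Rightarrow> ('a \<Rightarrow> real) \<Rightarrow> bool"
  where "norm_on V N \<longleftrightarrow>
    (\<forall>x\<in>carrier V. 0 \<le> N x) \<and>
    (\<forall>x\<in>carrier V. N x = 0 \<longleftrightarrow> x = \<zero>\<^bsub>V\<^esub>) \<and>
    (\<forall>a. \<forall>x\<in>carrier V. N (a \<odot>\<^bsub>V\<^esub> x) = \<bar>a\<bar> * N x) \<and>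
    (\<forall>x\<in>carrier V. \<forall>y\<in>carrier V. N (x \<oplus>\<^bsub>V\<^esub> y) \<le> N x + N y)"

definition real_normed_space :: "(real, 'a) module \<Rightarrow> ('a \<Rightarrow> real) \<Rightarrow> bool"
  where "real_normed_space V N \<longleftrightarrow> module real_ring V \<and> norm_on V N"


subsection \<open>Convexity and strong convexity of extended real valued functions\<close>

definition eff_dom :: "(real, 'a) module \<Rightarrow> ('a \<Rightarrow> ereal) \<Rightarrow> 'a set"
  where "eff_dom V f = {x \<in> carrier V. f x < \<infinity>}"

text \<open>The first conjunct says that the values of \<open>f\<close> lie in \<open>(-\<infinity>, \<infinity>]\<close>.\<close>

definition convex_fun :: "(real, 'a) module \<Rightarrow> ('a \<Rightarrow> ereal) \<Rightarrow> bool"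
  where "convex_fun V f \<longleftrightarrow>
    (\<forall>x\<in>carrier V. f x \<noteq> -\<infinity>) \<and>
    (\<forall>x\<in>carrier V. \<forall>y\<in>carrier V. \<forall>l::real. 0 < l \<and> l < 1 \<longrightarrow>
      f (l \<odot>\<^bsub>V\<^esub> x \<oplus>\<^bsub>V\<^esub> (1 - l) \<odot>\<^bsub>V\<^esub> y) \<le> ereal l * f x + ereal (1 - l) * f y)"

definition strongly_convex_on ::
    "(real, 'a) module \<Rightarrow> ('a \<Rightarrow> real) \<Rightarrow> ('a \<Rightarrow> ereal) \<Rightarrow> 'a set \<Rightarrow> real \<Rightarrow> bool"
  where "strongly_convex_on V N f S m \<longleftrightarrow>
    convex_fun V f \<and> S \<subseteq> eff_dom V f \<and> 0 < m \<and>
    (\<forall>x\<in>S. \<forall>y\<in>S. \<forall>l::real. 0 < l \<and> l < 1 \<longrightarrow>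
      f (l \<odot>\<^bsub>V\<^esub> x \<oplus>\<^bsub>V\<^esub> (1 - l) \<odot>\<^bsub>V\<^esub> y)
        + ereal (1 / 2 * m * l * (1 - l) * (N (x \<ominus>\<^bsub>V\<^esub> y))\<^sup>2)
      \<le> ereal l * f x + ereal (1 - l) * f y)"


subsection \<open>Sums over a countable index set with a fixed enumeration\<close>

text \<open>
  For infinite \<open>I\<close> the map \<open>e\<close> is meant to be a bijection from the natural numbers onto \<open>I\<close>,
  and sums are limits of partial sums in this order; for finite \<open>I\<close> it plays no role.
\<close>

definition fam_sums ::
    "'i set \<Rightarrow> (nat \<Rightarrow> 'i) \<Rightarrow> ('i \<Rightarrow> 'v::{comm_monoid_add, topological_space}) \<Rightarrow> 'v \<Rightarrow> bool"
  where "fam_sums I e f s \<longleftrightarrow> (if finite I then s = sum f I else (\<lambda>n. f (e n)) sums s)"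

definition fam_sum ::
    "'i set \<Rightarrow> (nat \<Rightarrow> 'i) \<Rightarrow> ('i \<Rightarrow> 'v::{comm_monoid_add, topological_space}) \<Rightarrow> 'v"
  where "fam_sum I e f = (if finite I then sum f I else (\<Sum>n. f (e n)))"


subsection \<open>The square-summable product of a family of normed spaces\<close>

text \<open>
  Families over \<open>I\<close> are functions that are \<open>undefined\<close> outside \<open>I\<close>. The ring multiplication and
  unit fields of the record are not used by modules.
\<close>

definition l2_space ::
    "'i set \<Rightarrow> (nat \<Rightarrow> 'i) \<Rightarrow> ('i \<Rightarrow> (real, 'a) module) \<Rightarrow> ('i \<Rightarrow> 'a \<Rightarrow> real)
      \<Rightarrow> (real, 'i \<Rightarrow> 'a) module"
  where "l2_space I e E nrm =
    \<lparr>carrier = {x \<in> (\<Pi>\<^sub>E i\<in>I. carrier (E i)). \<exists>r::real. fam_sums I e (\<lambda>i. (nrm i (x i))\<^sup>2) r},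
     monoid.mult = undefined, one = undefined,
     ring.zero = (\<lambda>i\<in>I. \<zero>\<^bsub>E i\<^esub>),
     add = (\<lambda>x y. \<lambda>i\<in>I. x i \<oplus>\<^bsub>E i\<^esub> y i),
     module.smult = (\<lambda>a x. \<lambda>i\<in>I. a \<odot>\<^bsub>E i\<^esub> x i)\<rparr>"

definition l2_norm ::
    "'i set \<Rightarrow> (nat \<Rightarrow> 'i) \<Rightarrow> ('i \<Rightarrow> 'a \<Rightarrow> real) \<Rightarrow> ('i \<Rightarrow> 'a) \<Rightarrow> real"
  where "l2_norm I e nrm x = sqrt (fam_sum I e (\<lambda>i. (nrm i (x i))\<^sup>2))"

text \<open>The set \<open>\<Oplus>\<^sub>i A\<^sub>i\<close> of all members of the square-summable product with components in \<open>A\<^sub>i\<close>.\<close>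

definition l2_box ::
    "'i set \<Rightarrow> (nat \<Rightarrow> 'i) \<Rightarrow> ('i \<Rightarrow> (real, 'a) module) \<Rightarrow> ('i \<Rightarrow> 'a \<Rightarrow> real) \<Rightarrow> ('i \<Rightarrow> 'a set)
      \<Rightarrow> ('i \<Rightarrow> 'a) set"
  where "l2_box I e E nrm A = {x \<in> carrier (l2_space I e E nrm). \<forall>i\<in>I. x i \<in> A i}"

definition separable_sum ::
    "'i set \<Rightarrow> (nat \<Rightarrow> 'i) \<Rightarrow> ('i \<Rightarrow> (real, 'a) module) \<Rightarrow> ('i \<Rightarrow> 'a \<Rightarrow> real)
      \<Rightarrow> ('i \<Rightarrow> 'a \<Rightarrow> ereal) \<Rightarrow> ('i \<Rightarrow> 'a) \<Rightarrow> ereal"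
  where "separable_sum I e E nrm b x =
    (if x \<in> l2_box I e E nrm (\<lambda>i. eff_dom (E i) (b i)) then fam_sum I e (\<lambda>i. b i (x i)) else \<infinity>)"


text \<open>The square-summable product is a real vector space, so that it makes sense to norm it.\<close>

lemma real_ring_simps [simp]:
  "carrier real_ring = UNIV" "add real_ring = (+)" "monoid.mult real_ring = (*)"
  "one real_ring = 1" "ring.zero real_ring = 0"
  by (auto simp: ring_of_type_algebra_def)

lemma fam_sums_mono:
  fixes f g :: "'i \<Rightarrow> real"
  assumes "infinite I \<Longrightarrow> bij_betw e UNIV I" "fam_sums I e g s"
    and "\<And>i. i \<in> I \<Longrightarrow> 0 \<le> f i \<and> f i \<le> g i"
  shows "\<exists>r. fam_sums I e f r"
proof (cases "finite I")
  case True
  then show ?thesis by (simp add: fam_sums_def)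
next
  case False
  then have *: "e n \<in> I" for n
    using assms(1) by (auto simp: bij_betw_def)
  have "summable (\<lambda>n. g (e n))"
    using assms(2) False by (auto simp: fam_sums_def summable_def)
  then have "summable (\<lambda>n. f (e n))"
    by (rule summable_comparison_test'[where N = 0]) (use assms(3) * in auto)
  then show ?thesis
    using False by (auto simp: fam_sums_def summable_def)
qed

lemma l2_space_add_closed:
  assumes e: "infinite I \<Longrightarrow> bij_betw e UNIV I"
    and E: "\<And>i. i \<in> I \<Longrightarrow> real_normed_space (E i) (nrm i)"
    and x: "x \<in> carrier (l2_space I e E nrm)" and y: "y \<in> carrier (l2_space I e E nrm)"
  shows "(\<lambda>i\<in>I. x i \<oplus>\<^bsub>E i\<^esub> y i) \<in> carrier (l2_space I e E nrm)"
proof -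
  have m: "module real_ring (E i)" and n: "norm_on (E i) (nrm i)" if "i \<in> I" for i
    using E[OF that] by (auto simp: real_normed_space_def)
  have xi: "x i \<in> carrier (E i)" and yi: "y i \<in> carrier (E i)" if "i \<in> I" for i
    using x y that by (auto simp: l2_space_def)
  have pl: "x i \<oplus>\<^bsub>E i\<^esub> y i \<in> carrier (E i)" if "i \<in> I" for i
    using m[OF that] xi[OF that] yi[OF that]
    by (meson abelian_group.axioms(1) abelian_monoid.a_closed module.axioms(2))
  obtain r s where "fam_sums I e (\<lambda>i. (nrm i (x i))\<^sup>2) r" "fam_sums I e (\<lambda>i. (nrm i (y i))\<^sup>2) s"
    using x y by (auto simp: l2_space_def)
  then have "fam_sums I e (\<lambda>i. 2 * (nrm i (x i))\<^sup>2 + 2 * (nrm i (y i))\<^sup>2) (2 * r + 2 * s)"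
    by (auto simp: fam_sums_def sum.distrib sum_distrib_left split: if_splits
        intro!: sums_add sums_mult)
  then have "\<exists>t. fam_sums I e (\<lambda>i. (nrm i ((\<lambda>i\<in>I. x i \<oplus>\<^bsub>E i\<^esub> y i) i))\<^sup>2) t"
  proof (rule fam_sums_mono[rotated])
    fix i assume i: "i \<in> I"
    let ?u = "nrm i (x i)" and ?v = "nrm i (y i)" and ?w = "nrm i (x i \<oplus>\<^bsub>E i\<^esub> y i)"
    have "0 \<le> ?w" "?w \<le> ?u + ?v"
      using n[OF i] xi[OF i] yi[OF i] pl[OF i] by (auto simp: norm_on_def)
    then have "?w\<^sup>2 \<le> (?u + ?v)\<^sup>2"
      by (rule power_mono[rotated])
    also have "\<dots> \<le> 2 * ?u\<^sup>2 + 2 * ?v\<^sup>2"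
      using zero_le_power2[of "?u - ?v"] by (simp add: power2_eq_square algebra_simps)
    finally show "0 \<le> (nrm i ((\<lambda>i\<in>I. x i \<oplus>\<^bsub>E i\<^esub> y i) i))\<^sup>2 \<and>
        (nrm i ((\<lambda>i\<in>I. x i \<oplus>\<^bsub>E i\<^esub> y i) i))\<^sup>2 \<le> 2 * ?u\<^sup>2 + 2 * ?v\<^sup>2"
      using i by simp
  qed (use e in auto)
  then show ?thesis
    using pl by (auto simp: l2_space_def)
qed

lemma l2_space_smult_closed:
  fixes a :: real
  assumes e: "infinite I \<Longrightarrow> bij_betw e UNIV I"
    and E: "\<And>i. i \<in> I \<Longrightarrow> real_normed_space (E i) (nrm i)"
    and x: "x \<in> carrier (l2_space I e E nrm)"
  shows "(\<lambda>i\<in>I. a \<odot>\<^bsub>E i\<^esub> x i) \<in> carrier (l2_space I e E nrm)"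
proof -
  have m: "module real_ring (E i)" and n: "norm_on (E i) (nrm i)" if "i \<in> I" for i
    using E[OF that] by (auto simp: real_normed_space_def)
  have xi: "x i \<in> carrier (E i)" if "i \<in> I" for i
    using x that by (auto simp: l2_space_def)
  have sc: "a \<odot>\<^bsub>E i\<^esub> x i \<in> carrier (E i)" if "i \<in> I" for i
    using module.smult_closed[OF m[OF that]] xi[OF that] by simp
  obtain r where "fam_sums I e (\<lambda>i. (nrm i (x i))\<^sup>2) r"
    using x by (auto simp: l2_space_def)
  then have "fam_sums I e (\<lambda>i. a\<^sup>2 * (nrm i (x i))\<^sup>2) (a\<^sup>2 * r)"
    by (auto simp: fam_sums_def sum_distrib_left split: if_splits intro!: sums_mult)
  then have "\<exists>t. fam_sums I e (\<lambda>i. (nrm i ((\<lambda>i\<in>I. a \<odot>\<^bsub>E i\<^esub> x i) i))\<^sup>2) t"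
    by (rule fam_sums_mono[rotated]) (use e n xi in \<open>auto simp: norm_on_def power_mult_distrib\<close>)
  then show ?thesis
    using sc by (auto simp: l2_space_def)
qed

lemma l2_space_module:
  assumes e: "infinite I \<Longrightarrow> bij_betw e UNIV I"
    and E: "\<And>i. i \<in> I \<Longrightarrow> real_normed_space (E i) (nrm i)"
  shows "module real_ring (l2_space I e E nrm)"
proof -
  let ?X = "l2_space I e E nrm"
  have m: "module real_ring (E i)" and n: "norm_on (E i) (nrm i)" if "i \<in> I" for i
    using E[OF that] by (auto simp: real_normed_space_def)
  have g: "abelian_group (E i)" if "i \<in> I" for i
    using m[OF that] by (rule module.axioms)
  have mon: "abelian_monoid (E i)" if "i \<in> I" for i
    using g[OF that] by (rule abelian_group.axioms)
  have xi: "x i \<in> carrier (E i)" if "x \<in> carrier ?X" "i \<in> I" for x i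
    using that by (auto simp: l2_space_def)
  have ext: "x = y \<longleftrightarrow> (\<forall>i\<in>I. x i = y i)" if "x \<in> extensional I" "y \<in> extensional I" for x y :: "'a \<Rightarrow> 'b"
    using that by (auto intro: extensionalityI)
  have xe: "x \<in> extensional I" if "x \<in> carrier ?X" for x
    using that by (auto simp: l2_space_def PiE_def)
  have ops: "\<zero>\<^bsub>?X\<^esub> = (\<lambda>i\<in>I. \<zero>\<^bsub>E i\<^esub>)" "x \<oplus>\<^bsub>?X\<^esub> y = (\<lambda>i\<in>I. x i \<oplus>\<^bsub>E i\<^esub> y i)"
    "a \<odot>\<^bsub>?X\<^esub> x = (\<lambda>i\<in>I. a \<odot>\<^bsub>E i\<^esub> x i)" for x y a
    by (auto simp: l2_space_def)
  have zero: "(\<lambda>i\<in>I. \<zero>\<^bsub>E i\<^esub>) \<in> carrier ?X"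
  proof -
    have z: "\<zero>\<^bsub>E i\<^esub> \<in> carrier (E i)" if "i \<in> I" for i
      using mon[OF that] by (rule abelian_monoid.zero_closed)
    have "fam_sums I e (\<lambda>i. 0 :: real) 0"
      by (auto simp: fam_sums_def)
    then have "\<exists>t. fam_sums I e (\<lambda>i. (nrm i ((\<lambda>i\<in>I. \<zero>\<^bsub>E i\<^esub>) i))\<^sup>2) t"
      by (rule fam_sums_mono[rotated]) (use e n z in \<open>auto simp: norm_on_def\<close>)
    then show ?thesis
      using z by (auto simp: l2_space_def)
  qed
  note ac = l2_space_add_closed[OF e E]
  note sc = l2_space_smult_closed[OF e E]
  show ?thesis
  proof (rule moduleI)
    show "cring real_ring" by (rule cring_from_type_algebra)
    show "abelian_group ?X"
    proof (rule abelian_groupI)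
      fix x assume x: "x \<in> carrier ?X"
      let ?y = "(- 1 :: real) \<odot>\<^bsub>?X\<^esub> x"
      have "?y \<oplus>\<^bsub>?X\<^esub> x = \<zero>\<^bsub>?X\<^esub>"
      proof -
        have "(- 1 :: real) \<odot>\<^bsub>E i\<^esub> x i \<oplus>\<^bsub>E i\<^esub> x i = \<zero>\<^bsub>E i\<^esub>" if i: "i \<in> I" for i
        proof -
          interpret M: module real_ring "E i" by (rule m[OF i])
          have "(- 1 :: real) \<odot>\<^bsub>E i\<^esub> x i \<oplus>\<^bsub>E i\<^esub> x i
              = (- 1) \<odot>\<^bsub>E i\<^esub> x i \<oplus>\<^bsub>E i\<^esub> 1 \<odot>\<^bsub>E i\<^esub> x i"
            using M.smult_one[OF xi[OF x i]] by simp
          also have "\<dots> = 0 \<odot>\<^bsub>E i\<^esub> x i"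
            using M.smult_l_distr[of "- 1" 1 "x i"] xi[OF x i] by simp
          also have "\<dots> = \<zero>\<^bsub>E i\<^esub>"
            using n[OF i] M.smult_closed[of 0 "x i"] xi[OF x i]
            by (auto simp: norm_on_def)
          finally show ?thesis .
        qed
        then show ?thesis
          by (auto simp: ops ext)
      qed
      moreover have "?y \<in> carrier ?X"
        using sc[OF _ _ x] by (simp add: ops)
      ultimately show "\<exists>y\<in>carrier ?X. y \<oplus>\<^bsub>?X\<^esub> x = \<zero>\<^bsub>?X\<^esub>"
        by blast
    qed (auto simp: ops ext xe xi ac zero abelian_monoid.a_assoc[OF mon]
        abelian_monoid.l_zero[OF mon] intro: abelian_monoid.a_comm[OF mon])
  qed (auto simp: ops ext xe xi ac sc module.smult_l_distr[OF m, simplified]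
      module.smult_r_distr[OF m, simplified] module.smult_assoc1[OF m, simplified]
      module.smult_one[OF m, simplified])
qed

end

theory Submission
  imports Defs
begin

text \<open>
  Everything happens componentwise. Write \<open>z = l x + (1 - l) y\<close>. If \<open>x\<close> and \<open>y\<close> have finite
  components, so has \<open>z\<close>, because each \<open>b i\<close> is convex; the three sums that define the separable
  sum at \<open>x\<close>, \<open>y\<close>, \<open>z\<close> then converge to real numbers, and every inequality

  \<open>b i (z i) + w i \<le> l * b i (x i) + (1 - l) * b i (y i)\<close>

  that holds in all components may be summed, provided that the sum of the \<open>w i\<close> converges
  (\<open>separable_sum_gap_le\<close>). Convexity is the case \<open>w = 0\<close>. Strong convexity is the case
  \<open>w i = 1/2 * \<mu> * l * (1 - l) * (nrm i (x i - y i))\<^sup>2\<close>, where \<open>\<mu>\<close> is the infimum of the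
  moduli \<open>mu i\<close>: these gaps sum to \<open>1/2 * \<mu> * l * (1 - l)\<close> times the squared \<open>\<ell>\<^sup>2\<close> norm of
  \<open>x - y\<close>, which is at least \<open>c\<^sup>2 * (N (x - y))\<^sup>2\<close> by the comparison of the two norms.
\<close>

section \<open>Real sums over an enumerated family\<close>

lemma fam_sum_eqI:
  fixes s :: "'v::{comm_monoid_add, t2_space}"
  assumes "fam_sums I e f s"
  shows "fam_sum I e f = s"
  using assms by (auto simp: fam_sums_def fam_sum_def sums_iff split: if_splits)

lemma fam_sums_cong:
  assumes "\<And>n. infinite I \<Longrightarrow> e n \<in> I" and "\<And>i. i \<in> I \<Longrightarrow> f i = g i"
  shows "fam_sums I e f s \<longleftrightarrow> fam_sums I e g s"
  using assms by (simp add: fam_sums_def cong: sum.cong)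

lemma fam_sums_ereal:
  "fam_sums I e (\<lambda>i. ereal (f i)) (ereal s) \<longleftrightarrow> fam_sums I e f s"
  by (simp add: fam_sums_def sums_def)

lemma fam_sums_add:
  fixes f g :: "'i \<Rightarrow> real"
  assumes "fam_sums I e f s" "fam_sums I e g t"
  shows "fam_sums I e (\<lambda>i. f i + g i) (s + t)"
  using assms by (auto simp: fam_sums_def sum.distrib split: if_splits intro!: sums_add)

lemma fam_sums_mult:
  fixes f :: "'i \<Rightarrow> real"
  assumes "fam_sums I e f s"
  shows "fam_sums I e (\<lambda>i. a * f i) (a * s)"
  using assms by (auto simp: fam_sums_def sum_distrib_left split: if_splits intro!: sums_mult)

lemma fam_sums_le:
  fixes f g :: "'i \<Rightarrow> real"
  assumes "\<And>n. infinite I \<Longrightarrow> e n \<in> I" and "fam_sums I e f s" "fam_sums I e g t"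
    and "\<And>i. i \<in> I \<Longrightarrow> f i \<le> g i"
  shows "s \<le> t"
proof (cases "finite I")
  case True
  then show ?thesis using assms by (auto simp: fam_sums_def intro: sum_mono)
next
  case False
  then have "(\<lambda>n. f (e n)) sums s" "(\<lambda>n. g (e n)) sums t"
    using assms by (auto simp: fam_sums_def)
  then show ?thesis
    by (rule sums_le[rotated]) (use False assms in auto)
qed

section \<open>Convex combinations and differences in the product space\<close>

lemma convex_fun_eff_dom_closed:
  assumes f: "convex_fun V f" and x: "x \<in> eff_dom V f" and y: "y \<in> eff_dom V f"
    and z: "l \<odot>\<^bsub>V\<^esub> x \<oplus>\<^bsub>V\<^esub> (1 - l) \<odot>\<^bsub>V\<^esub> y \<in> carrier V" and l: "0 < l" "l < 1"
  shows "l \<odot>\<^bsub>V\<^esub> x \<oplus>\<^bsub>V\<^esub> (1 - l) \<odot>\<^bsub>V\<^esub> y \<in> eff_dom V f"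
proof -
  have "f (l \<odot>\<^bsub>V\<^esub> x \<oplus>\<^bsub>V\<^esub> (1 - l) \<odot>\<^bsub>V\<^esub> y) \<le> ereal l * f x + ereal (1 - l) * f y"
    using f x y l by (auto simp: convex_fun_def eff_dom_def)
  also have "\<dots> < \<infinity>"
    using x y l by (cases "f x"; cases "f y") (auto simp: eff_dom_def)
  finally show ?thesis
    using z by (simp add: eff_dom_def)
qed

lemma l2_space_convex_comb_eq:
  "l \<odot>\<^bsub>l2_space I e E nrm\<^esub> x \<oplus>\<^bsub>l2_space I e E nrm\<^esub> k \<odot>\<^bsub>l2_space I e E nrm\<^esub> y
    = (\<lambda>i\<in>I. l \<odot>\<^bsub>E i\<^esub> x i \<oplus>\<^bsub>E i\<^esub> k \<odot>\<^bsub>E i\<^esub> y i)"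
  by (auto simp: l2_space_def)

text \<open>
  The additive inverse of the product space is not a componentwise definition but the element
  singled out by the group laws. The equation \<open>(x - y) + y = x\<close> nevertheless determines every
  component of \<open>x - y\<close>, since addition is componentwise.
\<close>

lemma l2_space_minus_component:
  assumes e: "infinite I \<Longrightarrow> bij_betw e UNIV I"
    and E: "\<And>i. i \<in> I \<Longrightarrow> real_normed_space (E i) (nrm i)"
    and x: "x \<in> carrier (l2_space I e E nrm)" and y: "y \<in> carrier (l2_space I e E nrm)"
    and i: "i \<in> I"
  shows "(x \<ominus>\<^bsub>l2_space I e E nrm\<^esub> y) i = x i \<ominus>\<^bsub>E i\<^esub> y i"
proof -
  let ?X = "l2_space I e E nrm"
  interpret X: module real_ring ?X
    by (rule l2_space_module[OF e E])
  interpret V: module real_ring "E i"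
    using E[OF i] by (simp add: real_normed_space_def)
  let ?d = "x \<ominus>\<^bsub>?X\<^esub> y"
  have d: "?d \<in> carrier ?X"
    using x y by (rule X.minus_closed)
  have comp: "u i \<in> carrier (E i)" if "u \<in> carrier ?X" for u
    using that i by (auto simp: l2_space_def)
  have "?d \<oplus>\<^bsub>?X\<^esub> y = x"
    using x y by (simp add: a_minus_def X.a_assoc X.l_neg)
  then have "(?d \<oplus>\<^bsub>?X\<^esub> y) i = x i"
    by simp
  then have "?d i \<oplus>\<^bsub>E i\<^esub> y i = x i"
    using i by (simp add: l2_space_def)
  then have "x i \<ominus>\<^bsub>E i\<^esub> y i = (?d i \<oplus>\<^bsub>E i\<^esub> y i) \<ominus>\<^bsub>E i\<^esub> y i"
    by simp
  also have "\<dots> = ?d i"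
    using comp[OF d] comp[OF y] by (simp add: a_minus_def V.a_assoc V.r_neg)
  finally show ?thesis ..
qed

lemma l2_norm_squared_sums:
  assumes e: "\<And>n. infinite I \<Longrightarrow> e n \<in> I" and x: "x \<in> carrier (l2_space I e E nrm)"
  shows "fam_sums I e (\<lambda>i. (nrm i (x i))\<^sup>2) ((l2_norm I e nrm x)\<^sup>2)"
proof -
  obtain r where r: "fam_sums I e (\<lambda>i. (nrm i (x i))\<^sup>2) r"
    using x by (auto simp: l2_space_def)
  have "0 \<le> r"
    by (rule fam_sums_le[OF e _ r, where f = "\<lambda>i. 0"]) (auto simp: fam_sums_def)
  then show ?thesis
    using r fam_sum_eqI[OF r] by (simp add: l2_norm_def)
qed

section \<open>Separable sums\<close>

lemma separable_sum_real:
  assumes e: "\<And>n. infinite I \<Longrightarrow> e n \<in> I"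
    and proper: "\<And>i u. i \<in> I \<Longrightarrow> u \<in> carrier (E i) \<Longrightarrow> b i u \<noteq> -\<infinity>"
    and conv: "\<And>x. x \<in> l2_box I e E nrm (\<lambda>i. eff_dom (E i) (b i)) \<Longrightarrow>
           \<exists>r::real. fam_sums I e (\<lambda>i. b i (x i)) (ereal r)"
    and x: "x \<in> l2_box I e E nrm (\<lambda>i. eff_dom (E i) (b i))"
  obtains f s where "\<And>i. i \<in> I \<Longrightarrow> b i (x i) = ereal (f i)" "fam_sums I e f s"
    "separable_sum I e E nrm b x = ereal s"
proof -
  have real: "b i (x i) = ereal (real_of_ereal (b i (x i)))" if "i \<in> I" for i
    using x proper[OF that, of "x i"] that
    by (cases "b i (x i)") (auto simp: l2_box_def eff_dom_def)
  obtain s where s: "fam_sums I e (\<lambda>i. b i (x i)) (ereal s)"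
    using conv[OF x] by blast
  have "fam_sums I e (\<lambda>i. ereal (real_of_ereal (b i (x i)))) (ereal s)"
    using s fam_sums_cong[OF e real] by fast
  then have "fam_sums I e (\<lambda>i. real_of_ereal (b i (x i))) s"
    by (simp only: fam_sums_ereal)
  moreover have "separable_sum I e E nrm b x = ereal s"
    using x fam_sum_eqI[OF s] by (simp add: separable_sum_def)
  ultimately show ?thesis
    using that[OF real] by blast
qed

text \<open>
  All three sums are real on the box of effective domains, so the extended real inequality is
  one between convergent real series and survives the limit of the partial sums. The gaps
  \<open>w i\<close> may be any convergent family, so convexity and strong convexity are both instances.
\<close>

lemma separable_sum_gap_le:
  assumes e: "\<And>n. infinite I \<Longrightarrow> e n \<in> I"
    and proper: "\<And>i u. i \<in> I \<Longrightarrow> u \<in> carrier (E i) \<Longrightarrow> b i u \<noteq> -\<infinity>"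
    and conv: "\<And>x. x \<in> l2_box I e E nrm (\<lambda>i. eff_dom (E i) (b i)) \<Longrightarrow>
           \<exists>r::real. fam_sums I e (\<lambda>i. b i (x i)) (ereal r)"
    and x: "x \<in> l2_box I e E nrm (\<lambda>i. eff_dom (E i) (b i))"
    and y: "y \<in> l2_box I e E nrm (\<lambda>i. eff_dom (E i) (b i))"
    and z: "z \<in> l2_box I e E nrm (\<lambda>i. eff_dom (E i) (b i))"
    and w: "fam_sums I e w W"
    and le: "\<And>i. i \<in> I \<Longrightarrow> b i (z i) + ereal (w i) \<le> ereal l * b i (x i) + ereal k * b i (y i)"
  shows "separable_sum I e E nrm b z + ereal W
    \<le> ereal l * separable_sum I e E nrm b x + ereal k * separable_sum I e E nrm b y"
proof -
  obtain f s where f: "\<And>i. i \<in> I \<Longrightarrow> b i (x i) = ereal (f i)" "fam_sums I e f s"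
      "separable_sum I e E nrm b x = ereal s"
    using separable_sum_real[OF e proper conv x] by blast
  obtain g t where g: "\<And>i. i \<in> I \<Longrightarrow> b i (y i) = ereal (g i)" "fam_sums I e g t"
      "separable_sum I e E nrm b y = ereal t"
    using separable_sum_real[OF e proper conv y] by blast
  obtain h r where h: "\<And>i. i \<in> I \<Longrightarrow> b i (z i) = ereal (h i)" "fam_sums I e h r"
      "separable_sum I e E nrm b z = ereal r"
    using separable_sum_real[OF e proper conv z] by blast
  have "r + W \<le> l * s + k * t"
  proof (rule fam_sums_le[OF e])
    show "fam_sums I e (\<lambda>i. h i + w i) (r + W)"
      using h(2) w by (rule fam_sums_add)
    show "fam_sums I e (\<lambda>i. l * f i + k * g i) (l * s + k * t)"
      using f(2) g(2) by (intro fam_sums_add fam_sums_mult)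
    show "h i + w i \<le> l * f i + k * g i" if "i \<in> I" for i
      using le[OF that] f(1)[OF that] g(1)[OF that] h(1)[OF that] by simp
  qed
  then show ?thesis
    using f(3) g(3) h(3) by simp
qed

theorem proposition5p3:
  fixes I :: "'i set" and e :: "nat \<Rightarrow> 'i"
    and E :: "'i \<Rightarrow> (real, 'a) module" and nrm :: "'i \<Rightarrow> 'a \<Rightarrow> real"
    and b :: "'i \<Rightarrow> 'a \<Rightarrow> ereal" and S :: "'i \<Rightarrow> 'a set" and mu :: "'i \<Rightarrow> real"
    and N :: "('i \<Rightarrow> 'a) \<Rightarrow> real" and c :: real
  assumes "I \<noteq> {}" and "countable I"
    and "infinite I \<Longrightarrow> bij_betw e UNIV I"
    and "\<And>i. i \<in> I \<Longrightarrow> real_normed_space (E i) (nrm i)"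
    and "\<And>i. i \<in> I \<Longrightarrow> S i \<noteq> {}"
    and "\<And>i. i \<in> I \<Longrightarrow> strongly_convex_on (E i) (nrm i) (b i) (S i) (mu i)"
    and "(INF i\<in>I. mu i) > 0"
    and "norm_on (l2_space I e E nrm) N"
    and "c > 0"
    and "\<And>x. x \<in> carrier (l2_space I e E nrm) \<Longrightarrow> l2_norm I e nrm x \<ge> c * N x"
    and "\<And>x. x \<in> l2_box I e E nrm (\<lambda>i. eff_dom (E i) (b i)) \<Longrightarrow>
           \<exists>r::real. fam_sums I e (\<lambda>i. b i (x i)) (ereal r)"
  shows "strongly_convex_on (l2_space I e E nrm) N (separable_sum I e E nrm b)
           (l2_box I e E nrm S) (c\<^sup>2 * (INF i\<in>I. mu i))"
proof -
  let ?X = "l2_space I e E nrm" and ?b = "separable_sum I e E nrm b"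
  let ?D = "l2_box I e E nrm (\<lambda>i. eff_dom (E i) (b i))" and ?m = "INF i\<in>I. mu i"
  note e = assms(3) and E = assms(4) and sc = assms(6) and conv = assms(11)
  have eI: "e n \<in> I" if "infinite I" for n
    using e[OF that] by (auto simp: bij_betw_def)
  have cf: "convex_fun (E i) (b i)" and SD: "S i \<subseteq> eff_dom (E i) (b i)" and mu_pos: "0 < mu i"
    if "i \<in> I" for i
    using sc[OF that] by (auto simp: strongly_convex_on_def)
  have proper: "b i u \<noteq> -\<infinity>" if "i \<in> I" "u \<in> carrier (E i)" for i u
    using cf[OF that(1)] that(2) by (auto simp: convex_fun_def)
  have comp: "u i \<in> carrier (E i)" if "u \<in> carrier ?X" "i \<in> I" for u i
    using that by (auto simp: l2_space_def)
  have m_le: "?m \<le> mu i" if "i \<in> I" for i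
    by (rule cINF_lower[OF _ that]) (auto intro!: bdd_belowI[of _ 0] less_imp_le mu_pos)
  interpret X: module real_ring ?X
    by (rule l2_space_module[OF e E])

  define z where "z = (\<lambda>(l::real) x y. l \<odot>\<^bsub>?X\<^esub> x \<oplus>\<^bsub>?X\<^esub> (1 - l) \<odot>\<^bsub>?X\<^esub> y)"
  have z_comp: "z l x y i = l \<odot>\<^bsub>E i\<^esub> x i \<oplus>\<^bsub>E i\<^esub> (1 - l) \<odot>\<^bsub>E i\<^esub> y i" if "i \<in> I" for l x y i
    using that by (simp add: z_def l2_space_convex_comb_eq)
  have z_dom: "z l x y \<in> ?D" if "x \<in> ?D" "y \<in> ?D" "0 < l" "l < 1" for l x y
  proof -
    have c: "z l x y \<in> carrier ?X"
      using that by (simp add: z_def l2_box_def)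
    moreover have "z l x y i \<in> eff_dom (E i) (b i)" if i: "i \<in> I" for i
      using convex_fun_eff_dom_closed[OF cf[OF i], of "x i" "y i" l] comp[OF c i] z_comp[OF i]
        \<open>x \<in> ?D\<close> \<open>y \<in> ?D\<close> \<open>0 < l\<close> \<open>l < 1\<close> i by (auto simp: l2_box_def)
    ultimately show ?thesis
      by (simp add: l2_box_def)
  qed

  have b_proper: "?b x \<noteq> -\<infinity>" for x
  proof (cases "x \<in> ?D")
    case True
    then show ?thesis
      using separable_sum_real[OF eI proper conv True] by (metis MInfty_neq_ereal(1))
  qed (simp add: separable_sum_def)

  have convex: "convex_fun ?X ?b"
    unfolding convex_fun_def
  proof (intro conjI ballI allI impI)
    fix x y and l :: real
    assume xy: "x \<in> carrier ?X" "y \<in> carrier ?X" and "0 < l \<and> l < 1"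
    then have l: "0 < l" "l < 1" by auto
    show "?b (l \<odot>\<^bsub>?X\<^esub> x \<oplus>\<^bsub>?X\<^esub> (1 - l) \<odot>\<^bsub>?X\<^esub> y) \<le> ereal l * ?b x + ereal (1 - l) * ?b y"
    proof (cases "x \<in> ?D \<and> y \<in> ?D")
      case True
      have "?b (z l x y) + ereal 0 \<le> ereal l * ?b x + ereal (1 - l) * ?b y"
      proof (rule separable_sum_gap_le[OF eI proper conv _ _ z_dom])
        show "fam_sums I e (\<lambda>i. 0) 0"
          by (simp add: fam_sums_def)
        show "b i (z l x y i) + ereal 0 \<le> ereal l * b i (x i) + ereal (1 - l) * b i (y i)"
          if "i \<in> I" for i
          using cf[OF that] comp[OF _ that] xy l by (simp add: z_comp[OF that] convex_fun_def)
      qed (use True l in auto)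
      then show ?thesis
        by (simp add: z_def)
    next
      case False
      then have "?b x = \<infinity> \<or> ?b y = \<infinity>"
        by (auto simp: separable_sum_def)
      \<comment> \<open>Neither value is \<open>-\<infinity>\<close>, so the infinite one decides the sum.\<close>
      then have "ereal l * ?b x + ereal (1 - l) * ?b y = \<infinity>"
        using l b_proper[of x] b_proper[of y] by (cases "?b x"; cases "?b y") auto
      then show ?thesis
        by (metis ereal_less_eq(1))
    qed
  qed (rule b_proper)

  have S_dom: "l2_box I e E nrm S \<subseteq> ?D"
    using SD by (auto simp: l2_box_def)
  have S_eff: "l2_box I e E nrm S \<subseteq> eff_dom ?X ?b"
  proof
    fix x assume "x \<in> l2_box I e E nrm S"
    then have x: "x \<in> ?D" "x \<in> carrier ?X"
      using S_dom by (auto simp: l2_box_def)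
    obtain s where "?b x = ereal s"
      using separable_sum_real[OF eI proper conv x(1)] by blast
    then show "x \<in> eff_dom ?X ?b"
      using x(2) by (simp add: eff_dom_def)
  qed

  \<comment> \<open>The modulus \<open>?m\<close> has to be uniform in \<open>i\<close> for the gaps to add up to a multiple of the
    squared \<open>\<ell>\<^sup>2\<close> norm; the comparison of norms is applied after summation.\<close>
  have gap: "?b (z l x y) + ereal (1 / 2 * (c\<^sup>2 * ?m) * l * (1 - l) * (N (x \<ominus>\<^bsub>?X\<^esub> y))\<^sup>2)
      \<le> ereal l * ?b x + ereal (1 - l) * ?b y"
    if xS: "x \<in> l2_box I e E nrm S" and yS: "y \<in> l2_box I e E nrm S" and l: "0 < l" "l < 1"
    for x y l
  proof -
    let ?d = "x \<ominus>\<^bsub>?X\<^esub> y" and ?k = "1 / 2 * ?m * l * (1 - l)"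
    have xy: "x \<in> ?D" "y \<in> ?D" "x \<in> carrier ?X" "y \<in> carrier ?X"
      using xS yS S_dom by (auto simp: l2_box_def)
    have d: "?d \<in> carrier ?X"
      using xy by simp
    have k: "0 \<le> ?k"
      using assms(7) l by simp
    have "0 \<le> N ?d"
      using assms(8) d by (simp add: norm_on_def)
    then have "(c * N ?d)\<^sup>2 \<le> (l2_norm I e nrm ?d)\<^sup>2"
      using assms(9) assms(10)[OF d] by (intro power_mono) auto
    then have "?k * (c * N ?d)\<^sup>2 \<le> ?k * (l2_norm I e nrm ?d)\<^sup>2"
      using k by (rule mult_left_mono)
    then have "?b (z l x y) + ereal (1 / 2 * (c\<^sup>2 * ?m) * l * (1 - l) * (N ?d)\<^sup>2)
        \<le> ?b (z l x y) + ereal (?k * (l2_norm I e nrm ?d)\<^sup>2)"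
      by (intro add_left_mono) (simp add: power_mult_distrib mult_ac)
    also have "\<dots> \<le> ereal l * ?b x + ereal (1 - l) * ?b y"
    proof (rule separable_sum_gap_le[OF eI proper conv xy(1,2) z_dom[OF xy(1,2) l]])
      show "fam_sums I e (\<lambda>i. ?k * (nrm i (?d i))\<^sup>2) (?k * (l2_norm I e nrm ?d)\<^sup>2)"
        by (intro fam_sums_mult l2_norm_squared_sums[OF eI d])
      fix i assume i: "i \<in> I"
      have di: "?d i = x i \<ominus>\<^bsub>E i\<^esub> y i"
        by (rule l2_space_minus_component[OF e E xy(3,4) i])
      have "?k * (nrm i (?d i))\<^sup>2 \<le> 1 / 2 * mu i * l * (1 - l) * (nrm i (?d i))\<^sup>2"
        using m_le[OF i] l by (intro mult_right_mono) auto
      then have "b i (z l x y i) + ereal (?k * (nrm i (?d i))\<^sup>2)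
          \<le> b i (z l x y i) + ereal (1 / 2 * mu i * l * (1 - l) * (nrm i (?d i))\<^sup>2)"
        by (intro add_left_mono) simp
      also have "\<dots> \<le> ereal l * b i (x i) + ereal (1 - l) * b i (y i)"
        using sc[OF i] xS yS i l
        unfolding z_comp[OF i] di strongly_convex_on_def l2_box_def by blast
      finally show "b i (z l x y i) + ereal (?k * (nrm i (?d i))\<^sup>2)
          \<le> ereal l * b i (x i) + ereal (1 - l) * b i (y i)" .
    qed
    finally show ?thesis .
  qed

  show ?thesis
    unfolding strongly_convex_on_def
    using convex S_eff gap assms(7,9) by (auto simp: z_def)
qed

end
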